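(* The set of contraction apex graphs is not closed under taking minors; that is, there exist a graph $G$ that is contraction apex and a minor of $G$ that is not contraction apex.
   Context: Graphs are finite, simple and undirected. $G/e$ is the graph obtained by contracting the edge $e$, where any doubled edge produced is replaced by a single edge so that the graph stays simple. A graph $H$ is a minor of $G$ if $H$ can be obtained by contracting edges in a subgraph of $G$. A graph $G$ is contraction apex if there is an edge $e\in E(G)$ such that $G/e$ is planar; every planar graph (including graphs with no edges) is counted as contraction apex. *)

theory Defs
  imports
    "HOL-Analysis.Analysis"
    "Graph_Theory.Pair_Digraph"
    "Graph_Theory.Digraph_Component"
    "Graph_Theory.Digraph_Isomorphism"
begin

text \<open>
  A finite simple undirected graph is a \<^locale>\<open>pair_graph\<close>: a finite, loop-free, symmetric
  digraph without parallel arcs. An undirected edge is represented by its two orientations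
  \<open>(u, v)\<close> and \<open>(v, u)\<close>.
\<close>

text \<open>
  Contracting \<open>(u, v)\<close> identifies \<open>v\<close> with \<open>u\<close>; the merged vertex keeps the name \<open>u\<close>.
  Arcs that become loops are dropped, and doubled edges coincide because arcs are pairs.
\<close>

definition contract_edge :: "'a pair_pre_digraph \<Rightarrow> 'a \<times> 'a \<Rightarrow> 'a pair_pre_digraph" where
  "contract_edge G e =
    (let h = (\<lambda>x. if x = snd e then fst e else x)
     in \<lparr> pverts = h ` pverts G,
          parcs = {(h x, h y) | x y. (x, y) \<in> parcs G \<and> h x \<noteq> h y} \<rparr>)"

inductive contracts_to :: "'a pair_pre_digraph \<Rightarrow> 'a pair_pre_digraph \<Rightarrow> bool" for G where
  refl: "contracts_to G G"
| step: "\<lbrakk>contracts_to G K; e \<in> parcs K\<rbrakk> \<Longrightarrow> contracts_to G (contract_edge K e)"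

text \<open>Minors are taken up to isomorphism, since the name of a merged vertex is immaterial.\<close>

definition minor :: "'b pair_pre_digraph \<Rightarrow> 'a pair_pre_digraph \<Rightarrow> bool" where
  "minor H G \<longleftrightarrow>
    (\<exists>S K. pair_graph S \<and> subgraph (with_proj S) (with_proj G) \<and> contracts_to S K
      \<and> digraph_iso (with_proj K) (with_proj H))"

definition uedges :: "'a pair_pre_digraph \<Rightarrow> 'a set set" where
  "uedges G = (\<lambda>(u, v). {u, v}) ` parcs G"

text \<open>
  Planarity is topological: vertices are distinct points of the plane, every undirected edge is a
  simple arc joining its two ends and passing through no other vertex, and two distinct edges meet
  only in common ends.
\<close>

definition plane_drawing ::
    "'a pair_pre_digraph \<Rightarrow> ('a \<Rightarrow> complex) \<Rightarrow> ('a set \<Rightarrow> real \<Rightarrow> complex) \<Rightarrow> bool" where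
  "plane_drawing G p \<gamma> \<longleftrightarrow>
    inj_on p (pverts G) \<and>
    (\<forall>e \<in> uedges G.
        arc (\<gamma> e) \<and> {pathstart (\<gamma> e), pathfinish (\<gamma> e)} = p ` e \<and>
        path_image (\<gamma> e) \<inter> p ` pverts G \<subseteq> p ` e) \<and>
    (\<forall>e \<in> uedges G. \<forall>e' \<in> uedges G. e \<noteq> e' \<longrightarrow>
        path_image (\<gamma> e) \<inter> path_image (\<gamma> e') \<subseteq> p ` (e \<inter> e'))"

definition planar :: "'a pair_pre_digraph \<Rightarrow> bool" where
  "planar G \<longleftrightarrow> (\<exists>p \<gamma>. plane_drawing G p \<gamma>)"

definition contraction_apex :: "'a pair_pre_digraph \<Rightarrow> bool" where
  "contraction_apex G \<longleftrightarrow> planar G \<or> (\<exists>e \<in> parcs G. planar (contract_edge G e))"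

end

theory Submission
  imports Defs "HOL-Complex_Analysis.Winding_Numbers"
begin

text \<open>
  Let \<open>H\<close> be \<open>K\<^bsub>3,4\<^esub>\<close> and let \<open>G\<close> be \<open>H\<close> with an additional edge joining two
  vertices of the part of size three. Contracting that edge gives \<open>K\<^bsub>2,4\<^esub>\<close>, which is planar.
  Contracting any edge \<open>uv\<close> of \<open>H\<close> leaves a graph containing \<open>K\<^bsub>3,3\<^esub>\<close>: the merged
  vertex is still adjacent to the three other vertices in the part of size four.

  For the nonplanarity of \<open>K\<^bsub>3,3\<^esub>\<close>, the three paths \<open>a\<^sub>1 b\<^sub>i a\<^sub>2\<close> form a theta
  curve. The winding numbers of its three cycles add up to zero, which forces one path to run inside
  the cycle formed by the other two. That path splits the inside of this cycle, so no face of the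
  theta curve has points of all three open paths on its boundary, whereas the face containing
  \<open>a\<^sub>3\<close> would have all of \<open>b\<^sub>1\<close>, \<open>b\<^sub>2\<close>, \<open>b\<^sub>3\<close> on its boundary.
\<close>

hide_const (open) Digraph_Component.connected

section \<open>Theta curves and the faces they bound\<close>

locale theta =
  fixes c1 c2 c3 :: "real \<Rightarrow> complex" and a b :: complex
  assumes arcs: "arc c1" "arc c2" "arc c3"
    and starts: "pathstart c1 = a" "pathstart c2 = a" "pathstart c3 = a"
    and finishes: "pathfinish c1 = b" "pathfinish c2 = b" "pathfinish c3 = b"
    and meets: "path_image c1 \<inter> path_image c2 = {a, b}" "path_image c2 \<inter> path_image c3 = {a, b}"
      "path_image c1 \<inter> path_image c3 = {a, b}"
begin

text \<open>The assumptions are symmetric under cyclic relabelling of the arcs, so results about the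
  cycle of \<open>c1\<close> and \<open>c2\<close> carry over to the other two cycles by
  interpretation.\<close>

lemma theta_rotate: "theta c2 c3 c1 a b"
  using arcs starts finishes meets by unfold_locales auto

lemma ends_distinct: "a \<noteq> b"
  using arcs(1) starts(1) finishes(1) arc_distinct_ends by metis

lemma ends_in_images:
  "a \<in> path_image c1" "b \<in> path_image c1" "a \<in> path_image c2" "b \<in> path_image c2"
  "a \<in> path_image c3" "b \<in> path_image c3"
  using meets by auto

lemma closed_curve:
  "simple_path (c1 +++ reversepath c2)"
  "pathfinish (c1 +++ reversepath c2) = pathstart (c1 +++ reversepath c2)"
  "path_image (c1 +++ reversepath c2) = path_image c1 \<union> path_image c2"
  using arcs starts finishes meets
  by (auto simp: simple_path_join_loop_eq arc_reversepath path_image_join)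

lemma inside_closed_curve:
  "inside (path_image c1 \<union> path_image c2) \<noteq> {}"
  "connected (inside (path_image c1 \<union> path_image c2))"
  "frontier (inside (path_image c1 \<union> path_image c2)) = path_image c1 \<union> path_image c2"
  using Jordan_inside_outside[OF closed_curve(1,2)] unfolding closed_curve(3) by auto

text \<open>A connected set that meets the inside without staying in it would cross the frontier,
  which is the curve itself by the Jordan curve theorem.\<close>

lemma connected_inside:
  assumes "connected S" "S \<inter> (path_image c1 \<union> path_image c2) = {}"
    "S \<inter> inside (path_image c1 \<union> path_image c2) \<noteq> {}"
  shows "S \<subseteq> inside (path_image c1 \<union> path_image c2)"
  using connected_Int_frontier[OF assms(1,3)] assms(2) unfolding inside_closed_curve(3) by blast

lemma winding_number_closed_curve:
  assumes "z \<notin> path_image c1" "z \<notin> path_image c2"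
  shows "winding_number (c1 +++ reversepath c2) z = winding_number c1 z - winding_number c2 z"
  using assms arcs starts finishes
  by (simp add: winding_number_join winding_number_reversepath arc_imp_path)

text \<open>The winding number of the cycle is the difference of those of its two arcs; it is 0
  outside and has norm 1 inside. Lying inside a cycle thus becomes a comparison of values attached
  to single arcs.\<close>

lemma winding_number_eq_iff_not_inside:
  assumes "z \<notin> path_image c1" "z \<notin> path_image c2"
  shows "winding_number c1 z = winding_number c2 z
    \<longleftrightarrow> z \<notin> inside (path_image c1 \<union> path_image c2)"
proof -
  have "z \<in> inside (path_image c1 \<union> path_image c2) \<or> z \<in> outside (path_image c1 \<union> path_image c2)"
    using assms inside_Un_outside[of "path_image c1 \<union> path_image c2"] by blast
  moreover have "winding_number (c1 +++ reversepath c2) z = 0"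
    if "z \<in> outside (path_image c1 \<union> path_image c2)"
    using that winding_number_zero_in_outside[of "c1 +++ reversepath c2" z] closed_curve
    by (simp add: simple_path_imp_path)
  moreover have "norm (winding_number (c1 +++ reversepath c2) z) = 1"
    if "z \<in> inside (path_image c1 \<union> path_image c2)"
    using that simple_closed_path_norm_winding_number_inside[of "c1 +++ reversepath c2" z] closed_curve
    by simp
  moreover have "z \<notin> outside (path_image c1 \<union> path_image c2)"
    if "z \<in> inside (path_image c1 \<union> path_image c2)"
    using that inside_Int_outside by blast
  ultimately show ?thesis
    using winding_number_closed_curve[OF assms] by auto
qed

text \<open>Each inside is connected and avoids the other cycle, so overlapping insides would
  contain each other. Equal insides have equal frontiers, which would leave \<open>c1\<close> with
  no points besides its ends.\<close>

lemma insides_not_overlapping: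
  assumes "path_image c3 \<inter> inside (path_image c1 \<union> path_image c2) = {}"
    and "path_image c1 \<inter> inside (path_image c2 \<union> path_image c3) = {}"
  shows "inside (path_image c1 \<union> path_image c2) \<inter> inside (path_image c2 \<union> path_image c3) = {}"
proof (rule ccontr)
  interpret r: theta c2 c3 c1 a b by (rule theta_rotate)
  let ?I = "inside (path_image c1 \<union> path_image c2)" and ?J = "inside (path_image c2 \<union> path_image c3)"
  assume "?I \<inter> ?J \<noteq> {}"
  then have "?I \<subseteq> ?J" "?J \<subseteq> ?I"
    using r.connected_inside[OF inside_closed_curve(2)] connected_inside[OF r.inside_closed_curve(2)]
      assms inside_no_overlap[of "path_image c1 \<union> path_image c2"]
      inside_no_overlap[of "path_image c2 \<union> path_image c3"] by blast+
  then have "?I = ?J"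
    by (rule subset_antisym)
  then have "path_image c1 \<union> path_image c2 = path_image c2 \<union> path_image c3"
    using inside_closed_curve(3) r.inside_closed_curve(3) by metis
  then have "path_image c1 \<subseteq> {a, b}"
    using meets by blast
  then show False
    using nonempty_simple_path_endless[of c1] arcs(1) starts(1) finishes(1) arc_imp_simple_path
    by auto
qed

text \<open>Otherwise the inside of the cycle of \<open>c1\<close> and \<open>c2\<close> is disjoint
  from the other two insides. But at a point \<open>z\<close> of it the winding numbers of
  \<open>c1\<close> and \<open>c2\<close> differ, so that of \<open>c3\<close> differs from one of
  them and \<open>z\<close> lies in a second inside.\<close>

lemma one_arc_inside:
  "path_image c3 \<inter> inside (path_image c1 \<union> path_image c2) \<noteq> {} \<or>
   path_image c1 \<inter> inside (path_image c2 \<union> path_image c3) \<noteq> {} \<or>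
   path_image c2 \<inter> inside (path_image c3 \<union> path_image c1) \<noteq> {}"
proof (rule ccontr)
  interpret r: theta c2 c3 c1 a b by (rule theta_rotate)
  interpret s: theta c3 c1 c2 a b by (rule r.theta_rotate)
  assume none: "\<not> ?thesis"
  obtain z where z: "z \<in> inside (path_image c1 \<union> path_image c2)"
    using inside_closed_curve(1) by blast
  then have off: "z \<notin> path_image c1" "z \<notin> path_image c2" "z \<notin> path_image c3"
    using none inside_no_overlap[of "path_image c1 \<union> path_image c2"] by blast+
  have "winding_number c1 z \<noteq> winding_number c2 z"
    using winding_number_eq_iff_not_inside off z by blast
  then have "z \<in> inside (path_image c2 \<union> path_image c3) \<or> z \<in> inside (path_image c3 \<union> path_image c1)"
    using r.winding_number_eq_iff_not_inside s.winding_number_eq_iff_not_inside off by metis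
  then show False
    using none z insides_not_overlapping s.insides_not_overlapping by blast
qed

text \<open>The sets \<open>S1\<close>, \<open>S2\<close>, \<open>S3\<close> are connected links
  from \<open>x\<close> to the three arcs. The arc \<open>c3\<close> cuts the inside into two
  regions. Whichever of them contains \<open>x\<close>, either \<open>S1\<close> or
  \<open>S2\<close> is trapped in it, although it must reach a point of the outer cycle.\<close>

lemma no_common_face_aux:
  assumes "path_image c3 \<inter> inside (path_image c1 \<union> path_image c2) \<noteq> {}"
    and "connected S1" "connected S2" "connected S3" and x: "x \<in> S1" "x \<in> S2" "x \<in> S3"
    and "S1 \<inter> path_image c1 \<noteq> {}" "S2 \<inter> path_image c2 \<noteq> {}" "S3 \<inter> path_image c3 \<noteq> {}"
    and S1: "S1 \<inter> (path_image c2 \<union> path_image c3) = {}"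
    and S2: "S2 \<inter> (path_image c3 \<union> path_image c1) = {}"
    and S3: "S3 \<inter> (path_image c1 \<union> path_image c2) = {}"
  shows False
proof -
  interpret r: theta c2 c3 c1 a b by (rule theta_rotate)
  interpret s: theta c3 c1 c2 a b by (rule r.theta_rotate)
  have split: "inside (path_image c1 \<union> path_image c3) \<union> inside (path_image c2 \<union> path_image c3) \<union>
      (path_image c3 - {a, b}) = inside (path_image c1 \<union> path_image c2)"
    using split_inside_simple_closed_curve[of c1 a b c2 c3] arcs starts finishes ends_distinct meets
      assms(1) arc_imp_simple_path by metis
  obtain y1 y2 y3 where y: "y1 \<in> S1" "y1 \<in> path_image c1" "y2 \<in> S2" "y2 \<in> path_image c2"
    "y3 \<in> S3" "y3 \<in> path_image c3"
    using assms by blast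
  \<comment> \<open>\<open>S3\<close> avoids \<open>c1\<close> and hence both ends, so
    \<open>y3\<close> is an interior point of \<open>c3\<close>.\<close>
  then have "y3 \<in> inside (path_image c1 \<union> path_image c2)"
    using split S3 ends_in_images by blast
  then have "x \<in> inside (path_image c1 \<union> path_image c2)"
    using connected_inside[OF \<open>connected S3\<close> S3] y x by blast
  \<comment> \<open>Since \<open>S1\<close> avoids \<open>c3\<close>, the point \<open>x\<close> is
    not on the dividing arc.\<close>
  then have "x \<in> inside (path_image c3 \<union> path_image c1) \<or> x \<in> inside (path_image c2 \<union> path_image c3)"
    using split x S1 by (auto simp: Un_commute)
  then have "y1 \<in> inside (path_image c2 \<union> path_image c3) \<or> y2 \<in> inside (path_image c3 \<union> path_image c1)"
    using s.connected_inside[OF \<open>connected S2\<close> S2] r.connected_inside[OF \<open>connected S1\<close> S1] y x by blast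
  then have "y1 \<in> inside (path_image c1 \<union> path_image c2) \<or> y2 \<in> inside (path_image c1 \<union> path_image c2)"
    using split by (auto simp: Un_commute)
  then show False
    using y inside_no_overlap[of "path_image c1 \<union> path_image c2"] by blast
qed

text \<open>Some arc runs inside the cycle of the other two; a rotation makes it the third arc, and
  the index lists permute the hypotheses to match.\<close>

lemma no_common_face:
  assumes "connected S1" "connected S2" "connected S3" "x \<in> S1" "x \<in> S2" "x \<in> S3"
    and "S1 \<inter> path_image c1 \<noteq> {}" "S2 \<inter> path_image c2 \<noteq> {}" "S3 \<inter> path_image c3 \<noteq> {}"
    and "S1 \<inter> (path_image c2 \<union> path_image c3) = {}"
    and "S2 \<inter> (path_image c3 \<union> path_image c1) = {}"
    and "S3 \<inter> (path_image c1 \<union> path_image c2) = {}"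
  shows False
proof -
  interpret r: theta c2 c3 c1 a b by (rule theta_rotate)
  interpret s: theta c3 c1 c2 a b by (rule r.theta_rotate)
  show False
    using one_arc_inside no_common_face_aux[OF _ assms]
      r.no_common_face_aux[OF _ assms(2,3,1,5,6,4,8,9,7,11,12,10)]
      s.no_common_face_aux[OF _ assms(3,1,2,6,4,5,9,7,8,12,10,11)]
    by blast
qed

end

section \<open>Complete bipartite graphs and nonplanarity of K33\<close>

definition complete_bipartite :: "'a set \<Rightarrow> 'a set \<Rightarrow> 'a pair_pre_digraph" where
  "complete_bipartite A B = \<lparr> pverts = A \<union> B, parcs = A \<times> B \<union> B \<times> A \<rparr>"

lemma complete_bipartite_simps [simp]:
  "pverts (complete_bipartite A B) = A \<union> B"
  "parcs (complete_bipartite A B) = A \<times> B \<union> B \<times> A"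
  by (simp_all add: complete_bipartite_def)

lemma pair_graph_complete_bipartite:
  assumes "finite A" "finite B" "A \<inter> B = {}"
  shows "pair_graph (complete_bipartite A B)"
  using assms by unfold_locales (auto simp: symmetric_def intro!: symI)

text \<open>A drawing attaches an arc to an unordered edge, so its direction is unknown; reversing
  it if necessary makes it start at \<open>p u\<close>.\<close>

lemma plane_drawing_edge_arc:
  assumes "plane_drawing G p \<gamma>" "(u, v) \<in> parcs G"
  obtains g where "arc g" "pathstart g = p u" "pathfinish g = p v"
    "path_image g = path_image (\<gamma> {u, v})"
proof -
  have "{u, v} \<in> uedges G"
    using assms(2) unfolding uedges_def by force
  then have "arc (\<gamma> {u, v})" and ends: "{pathstart (\<gamma> {u, v}), pathfinish (\<gamma> {u, v})} = {p u, p v}"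
    using assms(1) unfolding plane_drawing_def by auto
  from ends consider "pathstart (\<gamma> {u, v}) = p u" "pathfinish (\<gamma> {u, v}) = p v"
    | "pathstart (\<gamma> {u, v}) = p v" "pathfinish (\<gamma> {u, v}) = p u"
    by (auto simp: doubleton_eq_iff)
  then show thesis
    using that[of "\<gamma> {u, v}"] that[of "reversepath (\<gamma> {u, v})"] \<open>arc (\<gamma> {u, v})\<close>
    by cases (auto simp: arc_reversepath)
qed

text \<open>Formulated for graphs containing K33, so that it serves for \<open>H\<close> and for the
  contractions of \<open>H\<close> alike.\<close>

lemma K33_not_planar:
  assumes "card A = 3" "card B = 3" "A \<inter> B = {}" "A \<times> B \<subseteq> parcs G"
  shows "\<not> planar G"
proof
  assume "planar G"
  then obtain p \<gamma> where drawing: "plane_drawing G p \<gamma>"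
    unfolding planar_def by blast
  have "\<exists>g. arc g \<and> pathstart g = p u \<and> pathfinish g = p v \<and> path_image g = path_image (\<gamma> {u, v})"
    if "u \<in> A" "v \<in> B" for u v
    using plane_drawing_edge_arc[OF drawing, of u v] that assms(4) by blast
  then obtain g where g: "\<And>u v. u \<in> A \<Longrightarrow> v \<in> B \<Longrightarrow> arc (g u v) \<and> pathstart (g u v) = p u \<and>
      pathfinish (g u v) = p v \<and> path_image (g u v) = path_image (\<gamma> {u, v})"
    by metis
  have edge: "{u, v} \<in> uedges G" if "u \<in> A" "v \<in> B" for u v
    using that assms(4) unfolding uedges_def by force
  have meet: "path_image (g u v) \<inter> path_image (g u' v') \<subseteq> p ` ({u, v} \<inter> {u', v'})"
    if "u \<in> A" "v \<in> B" "u' \<in> A" "v' \<in> B" "(u, v) \<noteq> (u', v')" for u v u' v'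
  proof -
    have "{u, v} \<noteq> {u', v'}"
      using that assms(3) by (auto simp: doubleton_eq_iff)
    then show ?thesis
      using drawing edge[OF that(1,2)] edge[OF that(3,4)] g[OF that(1,2)] g[OF that(3,4)]
      unfolding plane_drawing_def by metis
  qed
  have ends: "p u \<in> path_image (g u v)" "p v \<in> path_image (g u v)" if "u \<in> A" "v \<in> B" for u v
    using g[OF that] by (metis pathstart_in_path_image, metis pathfinish_in_path_image)
  obtain a1 a2 a3 where A: "A = {a1, a2, a3}" "a1 \<noteq> a2" "a1 \<noteq> a3" "a2 \<noteq> a3"
    using assms(1) card_3_iff by metis
  obtain b1 b2 b3 where B: "B = {b1, b2, b3}" "b1 \<noteq> b2" "b1 \<noteq> b3" "b2 \<noteq> b3"
    using assms(2) card_3_iff by metis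
  \<comment> \<open>These become the arcs of the theta curve; the second edge is reversed so that
    all of them run from \<open>p a1\<close> to \<open>p a2\<close>.\<close>
  define c where "c v = g a1 v +++ reversepath (g a2 v)" for v
  have c: "arc (c v)" "pathstart (c v) = p a1" "pathfinish (c v) = p a2"
    "path_image (c v) = path_image (g a1 v) \<union> path_image (g a2 v)" if "v \<in> B" for v
  proof -
    have "path_image (g a1 v) \<inter> path_image (g a2 v) \<subseteq> {p v}"
      using meet[of a1 v a2 v] A that assms(3) by auto
    then show "arc (c v)"
      unfolding c_def using g[of a1 v] g[of a2 v] that A
      by (intro arc_join) (auto simp: arc_reversepath)
  qed (use g[of a1 v] g[of a2 v] that A in \<open>auto simp: c_def path_image_join\<close>)
  have c_meet: "path_image (c v) \<inter> path_image (c v') = {p a1, p a2}"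
    if "v \<in> B" "v' \<in> B" "v \<noteq> v'" for v v'
  proof
    show "path_image (c v) \<inter> path_image (c v') \<subseteq> {p a1, p a2}"
      unfolding c(4)[OF that(1)] c(4)[OF that(2)]
      using meet[of a1 v a1 v'] meet[of a1 v a2 v'] meet[of a2 v a1 v'] meet[of a2 v a2 v'] that A assms(3)
      by auto
    show "{p a1, p a2} \<subseteq> path_image (c v) \<inter> path_image (c v')"
      using c that pathstart_in_path_image pathfinish_in_path_image by (metis IntI empty_subsetI insert_subset)
  qed
  interpret theta "c b1" "c b2" "c b3" "p a1" "p a2"
    using B c c_meet by unfold_locales auto
  \<comment> \<open>The edge from \<open>a3\<close> to \<open>v\<close> has no end in common with
    either edge of the path through \<open>v'\<close>.\<close>
  have disj: "path_image (g a3 v) \<inter> path_image (c v') = {}" if "v \<in> B" "v' \<in> B" "v \<noteq> v'" for v v'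
    unfolding c(4)[OF that(2)]
    using meet[of a3 v a1 v'] meet[of a3 v a2 v'] that A assms(3) by auto
  have hit: "path_image (g a3 v) \<inter> path_image (c v) \<noteq> {}" if "v \<in> B" for v
    unfolding c(4)[OF that] using ends(2)[of a3 v] ends(2)[of a1 v] that A by blast
  have conn: "connected (path_image (g a3 v))" if "v \<in> B" for v
    using g[of a3 v] that A connected_path_image arc_imp_path by blast
  have "p a3 \<in> path_image (g a3 v)" if "v \<in> B" for v
    using ends(1)[of a3 v] that A by blast
  \<comment> \<open>The three edges at \<open>a3\<close> act as the connected links, with common
    point \<open>p a3\<close>.\<close>
  then show False
    using no_common_face[of "path_image (g a3 b1)" "path_image (g a3 b2)" "path_image (g a3 b3)" "p a3"]
      conn hit disj B by (simp add: Int_Un_distrib)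
qed

section \<open>Contractions of K34\<close>

lemma contract_edge_simps:
  assumes "h = (\<lambda>x. if x = snd e then fst e else x)"
  shows "pverts (contract_edge G e) = h ` pverts G"
    and "parcs (contract_edge G e) = {(h x, h y) |x y. (x, y) \<in> parcs G \<and> h x \<noteq> h y}"
  unfolding contract_edge_def Let_def assms by simp_all

lemma contract_K34_not_planar:
  assumes "card A = 3" "card B = 4" "A \<inter> B = {}" "e \<in> parcs (complete_bipartite A B)"
  shows "\<not> planar (contract_edge (complete_bipartite A B) e)"
proof -
  obtain u v where uv: "u \<in> A" "v \<in> B" "e = (u, v) \<or> e = (v, u)"
    using assms(4) by auto
  define h where "h = (\<lambda>x. if x = snd e then fst e else x)"
  have fixed: "h x = x" if "x \<notin> {u, v}" for x
    using that uv unfolding h_def by auto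
  \<comment> \<open>The merged vertex is named \<open>fst e\<close>, which may lie in either part;
    calling it \<open>h u\<close> treats both orientations of \<open>e\<close> at once.\<close>
  have hu: "h u \<in> {u, v}" "h u = h v"
    using uv assms(3) by (cases e; auto simp: h_def)+
  have hA: "h ` A = insert (h u) (A - {u})"
  proof -
    have "h ` (A - {u}) = A - {u}"
      using fixed uv(2) assms(3) by (force simp: image_iff)
    then show ?thesis
      using uv(1) by (metis image_insert insert_Diff)
  qed
  have "finite A" "finite B"
    using assms card.infinite by fastforce+
  then have "card (h ` A) = 3" "card (B - {v}) = 3"
    using assms uv hu unfolding hA by (auto simp: card_insert_if)
  moreover have disj: "h ` A \<inter> (B - {v}) = {}"
    using uv hu assms(3) unfolding hA by auto
  moreover have "h ` A \<times> (B - {v}) \<subseteq> parcs (contract_edge (complete_bipartite A B) e)"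
  proof
    fix z assume "z \<in> h ` A \<times> (B - {v})"
    then obtain x y where z: "z = (h x, y)" "x \<in> A" "y \<in> B" "y \<noteq> v"
      by blast
    then have "h y = y"
      using fixed[of y] uv(1) assms(3) by blast
    moreover have "h x \<noteq> y"
      using disj z by blast
    ultimately show "z \<in> parcs (contract_edge (complete_bipartite A B) e)"
      unfolding contract_edge_simps[OF h_def] using z
      by (intro CollectI exI[of _ x] exI[of _ y]) simp
  qed
  ultimately show ?thesis
    by (rule K33_not_planar)
qed

section \<open>A straight-line drawing of K2n\<close>

lemma planar_complete_bipartite_2:
  fixes f :: "'a \<Rightarrow> real"
  assumes "inj_on f B" "s \<notin> B" "t \<notin> B" "s \<noteq> t"
  shows "planar (complete_bipartite {s, t} B)"
proof -
  \<comment> \<open>The vertices of \<open>B\<close> go on the real axis, with \<open>s\<close>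
    above and \<open>t\<close> below it; all edges are straight segments.\<close>
  define p where "p x = (if x = s then \<i> else if x = t then - \<i> else complex_of_real (f x))" for x
  \<comment> \<open>An edge is an unordered set, so its ends are recovered by intersecting it with
    the two parts.\<close>
  define \<gamma> where "\<gamma> e = linepath (p (the_elem (e \<inter> {s, t}))) (p (the_elem (e \<inter> B)))" for e
  have \<gamma>: "\<gamma> {u, x} = linepath (p u) (p x)" if "u \<in> {s, t}" "x \<in> B" for u x
  proof -
    have "{u, x} \<inter> {s, t} = {u}" "{u, x} \<inter> B = {x}"
      using that assms by auto
    then show ?thesis by (simp add: \<gamma>_def)
  qed
  have p_s: "p s = \<i>" and p_t: "p t = - \<i>" and p_B: "\<And>x. x \<in> B \<Longrightarrow> p x = of_real (f x)"
    using assms by (auto simp: p_def)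
  have inj: "inj_on p ({s, t} \<union> B)"
    using assms p_B by (auto simp: inj_on_def p_s p_t complex_eq_iff)
  \<comment> \<open>\<open>\<sigma> u\<close> is the imaginary part of \<open>p u\<close>: the sign
    of the half-plane that holds the segments at \<open>u\<close>.\<close>
  define \<sigma> :: "'a \<Rightarrow> real" where "\<sigma> u = (if u = s then 1 else - 1)" for u
  have seg: "\<exists>r\<in>{0..1}. Re z = r * f x \<and> Im z = \<sigma> u * (1 - r)"
    if "u \<in> {s, t}" "x \<in> B" "z \<in> path_image (\<gamma> {u, x})" for u x z
    using that p_B[OF that(2)] assms(4)
    by (auto simp: \<gamma> closed_segment_def p_s p_t \<sigma>_def)
  have edges: "\<exists>u\<in>{s, t}. \<exists>x\<in>B. e = {u, x}" if "e \<in> uedges (complete_bipartite {s, t} B)" for e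
    using that unfolding uedges_def by auto
  have "plane_drawing (complete_bipartite {s, t} B) p \<gamma>"
    unfolding plane_drawing_def
  proof (intro conjI ballI impI)
    show "inj_on p (pverts (complete_bipartite {s, t} B))"
      using inj by simp
  next
    fix e assume "e \<in> uedges (complete_bipartite {s, t} B)"
    then obtain u x where ux: "u \<in> {s, t}" "x \<in> B" "e = {u, x}"
      using edges by blast
    have "p u \<noteq> p x"
      using ux assms p_B by (auto simp: p_s p_t complex_eq_iff)
    then show "arc (\<gamma> e)" "{pathstart (\<gamma> e), pathfinish (\<gamma> e)} = p ` e"
      using ux \<gamma> by auto
    show "path_image (\<gamma> e) \<inter> p ` pverts (complete_bipartite {s, t} B) \<subseteq> p ` e"
    proof
      fix z assume z: "z \<in> path_image (\<gamma> e) \<inter> p ` pverts (complete_bipartite {s, t} B)"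
      then obtain \<rho> where \<rho>: "Re z = \<rho> * f x" "Im z = \<sigma> u * (1 - \<rho>)" "0 \<le> \<rho>" "\<rho> \<le> 1"
        using seg[OF ux(1,2)] ux(3) by (metis IntD1 atLeastAtMost_iff)
      from z obtain w where w: "w \<in> {s, t} \<union> B" "z = p w"
        by auto
      consider "w = s" | "w = t" | "w \<in> B"
        using w by auto
      then have "w = u \<or> w = x"
      proof cases
        case 3
        then have "\<rho> = 1"
          using \<rho>(2) w p_B by (simp add: \<sigma>_def split: if_splits)
        then have "f w = f x"
          using \<rho>(1) 3 w p_B by simp
        then show ?thesis
          using 3 ux(2) assms(1) by (simp add: inj_on_def)
      qed (use \<rho> w ux(1) in \<open>auto simp: p_s p_t \<sigma>_def split: if_splits\<close>)
      then show "z \<in> p ` e"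
        using w ux(3) by auto
    qed
  next
    fix e e' assume "e \<in> uedges (complete_bipartite {s, t} B)" "e' \<in> uedges (complete_bipartite {s, t} B)"
      and "e \<noteq> e'"
    then obtain u x u' x' where ux: "u \<in> {s, t}" "x \<in> B" "e = {u, x}"
      "u' \<in> {s, t}" "x' \<in> B" "e' = {u', x'}"
      using edges by metis
    show "path_image (\<gamma> e) \<inter> path_image (\<gamma> e') \<subseteq> p ` (e \<inter> e')"
    proof
      fix z assume z: "z \<in> path_image (\<gamma> e) \<inter> path_image (\<gamma> e')"
      then obtain \<rho> \<rho>' where \<rho>: "Re z = \<rho> * f x" "Im z = \<sigma> u * (1 - \<rho>)" "\<rho> \<le> 1"
        and \<rho>': "Re z = \<rho>' * f x'" "Im z = \<sigma> u' * (1 - \<rho>')" "\<rho>' \<le> 1"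
        using seg[OF ux(1,2)] seg[OF ux(4,5)] ux(3,6) by (metis IntD1 IntD2 atLeastAtMost_iff)
      show "z \<in> p ` (e \<inter> e')"
      proof (cases "u = u'")
        \<comment> \<open>At equal height the parameters agree, and then distinct feet
          \<open>f x\<close> and \<open>f x'\<close> force the point to be the common apex.\<close>
        case True
        then have "\<rho> = \<rho>'" "x \<noteq> x'"
          using \<rho> \<rho>' \<open>e \<noteq> e'\<close> ux by (auto simp: \<sigma>_def split: if_splits)
        then have "\<rho> = 0"
          using \<rho>(1) \<rho>'(1) ux(2,5) assms(1) by (auto simp: inj_on_def)
        then have "z = p u"
          using \<rho> ux(1) by (auto simp: complex_eq_iff p_s p_t \<sigma>_def)
        then show ?thesis
          using True ux by auto
      next
        \<comment> \<open>The segments lie in opposite closed half-planes, so they can meet only on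
          the real axis, at their feet.\<close>
        case False
        then have "\<rho> = 1" "\<rho>' = 1"
          using \<rho> \<rho>' ux(1,4) assms(4) by (auto simp: \<sigma>_def split: if_splits)
        then have "x = x'" "z = p x"
          using \<rho> \<rho>' ux(2,5) assms(1) p_B by (auto simp: inj_on_def complex_eq_iff)
        then show ?thesis
          using ux by auto
      qed
    qed
  qed
  then show ?thesis
    unfolding planar_def by blast
qed

section \<open>Adding an edge within one part and contracting it\<close>

definition insert_edge :: "'a \<Rightarrow> 'a \<Rightarrow> 'a pair_pre_digraph \<Rightarrow> 'a pair_pre_digraph" where
  "insert_edge u v G = \<lparr> pverts = pverts G, parcs = {(u, v), (v, u)} \<union> parcs G \<rparr>"

lemma insert_edge_simps [simp]:
  "pverts (insert_edge u v G) = pverts G"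
  "parcs (insert_edge u v G) = {(u, v), (v, u)} \<union> parcs G"
  by (simp_all add: insert_edge_def)

lemma pair_graph_insert_edge:
  assumes "pair_graph G" "u \<in> pverts G" "v \<in> pverts G" "u \<noteq> v"
  shows "pair_graph (insert_edge u v G)"
proof -
  interpret pair_graph G by fact
  have "sym (parcs G)"
    using pair_sym_arcs by (simp add: symmetric_def)
  then have "sym ({(u, v), (v, u)} \<union> parcs G)"
    unfolding sym_def by blast
  then show ?thesis
    using assms(2-4) pair_finite_verts pair_finite_arcs pair_no_loops
    by unfold_locales (auto simp: symmetric_def dest: wellformed')
qed

text \<open>The new edge becomes a loop and is dropped, while the edges at \<open>v\<close> coincide
  with those from \<open>u\<close> to the same vertices of \<open>B\<close>.\<close>

lemma contract_insert_edge_complete_bipartite: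
  assumes "u \<in> A" "v \<in> A" "u \<noteq> v" "A \<inter> B = {}"
  shows "contract_edge (insert_edge u v (complete_bipartite A B)) (u, v)
    = complete_bipartite (A - {v}) B"
proof -
  define h where "h = (\<lambda>x. if x = snd (u, v) then fst (u, v) else x)"
  have hv: "h v = u" and fixed: "\<And>x. x \<noteq> v \<Longrightarrow> h x = x"
    by (auto simp: h_def)
  have hA: "h x \<in> A - {v}" if "x \<in> A" for x
    using that assms hv fixed by (cases "x = v") auto
  have hB: "h x = x" if "x \<in> B" for x
    using that assms(2,4) fixed[of x] by blast
  have "h ` (A \<union> B) = (A - {v}) \<union> B"
    using hA hB fixed by (force simp: image_iff)
  moreover have "{(h x, h y) |x y. (x, y) \<in> {(u, v), (v, u)} \<union> (A \<times> B \<union> B \<times> A) \<and> h x \<noteq> h y}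
    = (A - {v}) \<times> B \<union> B \<times> (A - {v})" (is "?L = ?R")
  proof
    show "?L \<subseteq> ?R"
      using hA hB hv fixed[OF assms(3)] by auto
    show "?R \<subseteq> ?L"
    proof
      fix z assume "z \<in> ?R"
      then obtain x y where z: "z = (x, y)" "(x, y) \<in> A \<times> B \<union> B \<times> A" "x \<noteq> v" "y \<noteq> v"
        using assms(2,4) by blast
      then have "x \<noteq> y"
        using assms(4) by blast
      then show "z \<in> ?L"
        using z fixed[of x] fixed[of y] by (intro CollectI exI[of _ x] exI[of _ y]) simp
    qed
  qed
  ultimately show ?thesis
    using contract_edge_simps[OF h_def, of "insert_edge u v (complete_bipartite A B)"]
    by (simp add: complete_bipartite_def)
qed

section \<open>The contraction apex graph and its minor\<close>

lemma digraph_iso_refl: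
  assumes "pair_wf_digraph G"
  shows "digraph_iso (with_proj G) (with_proj G)"
proof -
  let ?f = "\<lparr> iso_verts = id, iso_arcs = id, iso_head = snd, iso_tail = fst \<rparr>"
  have "pre_digraph.digraph_isomorphism (with_proj G) ?f"
    using assms by (simp add: pre_digraph.digraph_isomorphism_def wf_digraph_wp_iff)
  moreover have "with_proj G = app_iso ?f (with_proj G)"
    by (simp add: app_iso_def with_proj_def)
  ultimately show ?thesis
    unfolding digraph_iso_def by blast
qed

theorem theorem5p4:
  shows "\<exists>(G :: nat pair_pre_digraph) (H :: nat pair_pre_digraph).
    pair_graph G \<and> pair_graph H \<and> contraction_apex G \<and> minor H G \<and> \<not> contraction_apex H"
proof -
  define H :: "nat pair_pre_digraph" where "H = complete_bipartite {0, 1, 2} {3, 4, 5, 6}"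
  define G where "G = insert_edge 0 1 H"
  have H: "pair_graph H"
    unfolding H_def by (rule pair_graph_complete_bipartite) auto
  have G: "pair_graph G"
    unfolding G_def by (rule pair_graph_insert_edge[OF H]) (auto simp: H_def)
  have "{0, 1, 2} - {1} = {0, 2 :: nat}"
    by auto
  then have "contract_edge G (0, 1) = complete_bipartite {0, 2} {3, 4, 5, 6}"
    using contract_insert_edge_complete_bipartite[of 0 "{0, 1, 2 :: nat}" 1 "{3, 4, 5, 6}"]
    by (simp add: G_def H_def)
  then have "planar (contract_edge G (0, 1))"
    using planar_complete_bipartite_2[of real "{3, 4, 5, 6}" 0 2] by (simp add: inj_on_def)
  then have "contraction_apex G"
    unfolding contraction_apex_def by (auto simp: G_def)
  moreover have "minor H G"
  \<comment> \<open>\<open>H\<close> itself is the subgraph, with the empty sequence of contractions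
    and the identity isomorphism.\<close>
  proof -
    have wf: "wf_digraph (with_proj H)" "wf_digraph (with_proj G)" "pair_wf_digraph H"
      using H G by (auto simp: wf_digraph_wp_iff pair_graph_def pair_digraph_def pair_fin_digraph_def)
    then have "subgraph (with_proj H) (with_proj G)"
      by (auto simp: subgraph_def compatible_def G_def)
    then show ?thesis
      unfolding minor_def using H contracts_to.refl digraph_iso_refl[OF wf(3)] by blast
  qed
  moreover have "\<not> contraction_apex H"
  proof -
    \<comment> \<open>Planar graphs count as contraction apex, so \<open>H\<close> itself must be
      excluded too; any three vertices of the larger part give a K33.\<close>
    have "\<not> planar H"
      by (rule K33_not_planar[of "{0, 1, 2}" "{3, 4, 5}"]) (auto simp: H_def)
    moreover have "\<not> planar (contract_edge H e)" if "e \<in> parcs H" for e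
      using that unfolding H_def by (intro contract_K34_not_planar) auto
    ultimately show ?thesis
      unfolding contraction_apex_def by blast
  qed
  ultimately show ?thesis
    using G H by blast
qed

end
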